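(* Let $q\geq 3$ and let $p=2^q-1$ be a Mersenne prime (so $q$ is prime). Let $\mathbb{F}$ be the field of order $2^q$ and suppose that $a^{2i}+a^2+a+1=0$ for some positive integer $i$ and some primitive element $a$ of $\mathbb{F}$. Suppose furthermore that there exists a positive integer $j$ such that $2^j+i-1$ is divisible by $p$. Then there exists a $q$-homogeneous minimal Latin trade of size $pq$ in the Cayley table of the group $((\mathbb{Z}_2)^q,+)$.
   Context: The Cayley table $L$ of a group $(Q,+)$ is identified with its set of entries $\{(i,j,i+j)\mid i,j\in Q\}$ (row, column, symbol). A partial Latin square is a set of triples any two distinct of which agree in at most one coordinate; its size is its number of entries. A Latin trade in $L$ is a nonempty partial Latin square $T\subseteq L$ for which there is a partial Latin square $T'$ with $|T'|=|T|$, $T\cap T'=\emptyset$, and $(L\setminus T)\cup T'$ a Latin square; $(T,T')$ is then a Latin bitrade in $L$. $T$ is minimal if whenever $(U,U')$ is a Latin bitrade in $L$ with $U\subseteq T$, then $U=T$. $T$ is $k$-homogeneous if each row, each column and each symbol occurs in $T$ either $0$ or $k$ times. *)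

theory Defs
  imports
    "HOL-Computational_Algebra.Primes"
    "HOL-Algebra.Multiplicative_Group"
    "HOL-Algebra.Product_Groups"
begin

text \<open>An entry of an array is a triple (row, column, symbol).\<close>

definition cayley_table :: "('a, 'm) monoid_scheme \<Rightarrow> ('a \<times> 'a \<times> 'a) set" where
  "cayley_table G = {(x, y, x \<otimes>\<^bsub>G\<^esub> y) | x y. x \<in> carrier G \<and> y \<in> carrier G}"

definition partial_latin_square :: "('a \<times> 'a \<times> 'a) set \<Rightarrow> bool" where
  "partial_latin_square P \<longleftrightarrow>
     (\<forall>(r, c, s) \<in> P. \<forall>(r', c', s') \<in> P. (r, c, s) \<noteq> (r', c', s') \<longrightarrow>
        \<not> (r = r' \<and> c = c') \<and> \<not> (r = r' \<and> s = s') \<and> \<not> (c = c' \<and> s = s'))"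

definition latin_square :: "'a set \<Rightarrow> ('a \<times> 'a \<times> 'a) set \<Rightarrow> bool" where
  "latin_square Q L \<longleftrightarrow> L \<subseteq> Q \<times> Q \<times> Q \<and>
     (\<forall>r\<in>Q. \<forall>c\<in>Q. \<exists>!s. (r, c, s) \<in> L) \<and>
     (\<forall>r\<in>Q. \<forall>s\<in>Q. \<exists>!c. (r, c, s) \<in> L) \<and>
     (\<forall>c\<in>Q. \<forall>s\<in>Q. \<exists>!r. (r, c, s) \<in> L)"

definition latin_bitrade ::
    "('a, 'm) monoid_scheme \<Rightarrow> ('a \<times> 'a \<times> 'a) set \<Rightarrow> ('a \<times> 'a \<times> 'a) set \<Rightarrow> bool" where
  "latin_bitrade G T T' \<longleftrightarrow>
     T \<noteq> {} \<and> T \<subseteq> cayley_table G \<and>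
     partial_latin_square T \<and> partial_latin_square T' \<and>
     card T' = card T \<and> T \<inter> T' = {} \<and>
     latin_square (carrier G) ((cayley_table G - T) \<union> T')"

definition latin_trade :: "('a, 'm) monoid_scheme \<Rightarrow> ('a \<times> 'a \<times> 'a) set \<Rightarrow> bool" where
  "latin_trade G T \<longleftrightarrow> (\<exists>T'. latin_bitrade G T T')"

definition minimal_latin_trade :: "('a, 'm) monoid_scheme \<Rightarrow> ('a \<times> 'a \<times> 'a) set \<Rightarrow> bool" where
  "minimal_latin_trade G T \<longleftrightarrow>
     latin_trade G T \<and> (\<forall>U U'. latin_bitrade G U U' \<and> U \<subseteq> T \<longrightarrow> U = T)"

definition homogeneous :: "nat \<Rightarrow> ('a \<times> 'a \<times> 'a) set \<Rightarrow> bool" where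
  "homogeneous k T \<longleftrightarrow>
     (\<forall>x. card {(r, c, s) \<in> T. r = x} \<in> {0, k} \<and>
          card {(r, c, s) \<in> T. c = x} \<in> {0, k} \<and>
          card {(r, c, s) \<in> T. s = x} \<in> {0, k})"

definition primitive_element :: "('a, 'm) ring_scheme \<Rightarrow> 'a \<Rightarrow> bool" where
  "primitive_element F a \<longleftrightarrow>
     a \<in> carrier (mult_of F) \<and> generate (mult_of F) {a} = carrier (mult_of F)"

definition Z2_power :: "nat \<Rightarrow> (nat \<Rightarrow> int) monoid" where
  "Z2_power q = product_group {..<q} (\<lambda>_. integer_mod_group 2)"

end

theory Submission
  imports Defs "HOL-Number_Theory.Cong" "HOL-Library.Nat_Bijection"
begin

text \<open>
  Put \<open>b = 1/a\<close>, \<open>u = 1 + b\<close> and \<open>N = 2\<^sup>j\<close>. Modulo \<open>p\<close> we have \<open>i = 1 - N\<close>, so the equation for \<open>a\<close> becomes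
  \<open>b\<close> to the power \<open>2 N\<close> equals \<open>1 + b + b\<^sup>2\<close>, that is, \<open>u\<close> to the power \<open>2 N\<close> equals \<open>b u\<close>. Hence \<open>b\<close> is
  \<open>u\<close> to the power \<open>2 N - 1\<close>, and \<open>u\<close> generates the multiplicative group because \<open>p\<close> is prime.
  The trade \<open>T\<close> is the orbit of \<open>(1, b, u)\<close> under multiplication by scalars and the Frobenius map; writing
  nonzero elements as powers of \<open>u\<close>, its entries have exponents \<open>(z, z + (2 N - 1) v, z + v)\<close> with
  \<open>v\<close> a power of 2. Replacing the symbol exponent by \<open>z + N v\<close> gives the disjoint mate.

  For minimality, a new symbol \<open>z + v'\<close> in this cell must also occur in its column, which is a congruence
  modulo \<open>2\<^sup>q - 1\<close> between a sum of three powers of 2 and a sum of two. Uniqueness of binary expansions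
  forces \<open>v' = v\<close> or \<open>v' = N v\<close>, so a bitrade inside \<open>T\<close> contains with a cell the rest of its row
  (as \<open>q\<close> is prime and does not divide \<open>j\<close>), and then, through a column, the row shifted by \<open>2 N - 1\<close>,
  hence every row.
\<close>

section \<open>Sums of powers of 2 modulo a Mersenne number\<close>

lemma cong_power2_mod:
  fixes q k :: nat
  shows "[2 ^ k = 2 ^ (k mod q)] (mod (2 ^ q - 1 :: int))"
proof -
  have "[(2 ^ q) ^ (k div q) = 1 ^ (k div q)] (mod (2 ^ q - 1 :: int))"
    by (intro cong_pow) (simp add: cong_iff_dvd_diff)
  then have "[(2 ^ q) ^ (k div q) * 2 ^ (k mod q) = 1 * 2 ^ (k mod q)] (mod (2 ^ q - 1 :: int))"
    by (intro cong_mult) auto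
  then show ?thesis
    by (simp flip: power_mult power_add)
qed

lemma cong_power2_if_cong:
  fixes q k l :: nat
  assumes "[k = l] (mod q)"
  shows "[2 ^ k = 2 ^ l] (mod (2 ^ q - 1 :: int))"
  using cong_power2_mod[of k q] cong_power2_mod[of l q] assms
  by (metis cong_def)

text \<open>If \<open>m\<close> divides \<open>q\<close>, then \<open>2 ^ q\<close> reduces to
  \<open>2 ^ 0\<close> modulo \<open>2 ^ m - 1\<close>, so \<open>2 ^ m - 1\<close> divides the
  prime \<open>2 ^ q - 1\<close>.\<close>

lemma prime_exponent_of_mersenne_prime:
  fixes q :: nat
  assumes "Factorial_Ring.prime (2 ^ q - 1 :: nat)"
  shows "Factorial_Ring.prime q"
  unfolding prime_nat_iff
proof (intro conjI allI impI)
  have "q \<noteq> 0" "q \<noteq> 1"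
    using assms by (auto intro!: Nat.gr0I)
  then show "1 < q"
    by linarith
  fix m assume "m dvd q"
  then have "[2 ^ q = 2 ^ 0] (mod (2 ^ m - 1 :: int))"
    by (intro cong_power2_if_cong) (simp add: cong_def)
  then have "int (2 ^ m - 1) dvd int (2 ^ q - 1)"
    by (simp add: cong_iff_dvd_diff of_nat_diff)
  then have "2 ^ m - 1 dvd (2 ^ q - 1 :: nat)"
    by (simp only: of_nat_dvd_iff)
  with assms consider "2 ^ m - 1 = (1 :: nat)" | "2 ^ m - 1 = (2 ^ q - 1 :: nat)"
    by (auto simp: prime_nat_iff)
  then show "m = 1 \<or> m = q"
  proof cases
    case 1
    then have "(2 :: nat) ^ m = 2 ^ 1"
      by simp
    then have "m = 1"
      by (subst (asm) power_inject_exp) simp_all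
    then show ?thesis
      by simp
  next
    case 2
    then have "(2 :: nat) ^ m = 2 ^ q"
      by (metis Suc_diff_1 zero_less_numeral zero_less_power diff_Suc_1 One_nat_def)
    then show ?thesis
      by simp
  qed
qed

lemma set_encode_le:
  assumes "S \<subseteq> {..<q}"
  shows "set_encode S \<le> 2 ^ q - 1"
proof -
  have "set_encode S \<le> sum ((^) 2) {..<q}"
    unfolding set_encode_def using assms by (intro sum_mono2) auto
  also have "\<dots> = 2 ^ q - 1"
    by (metis atLeast0LessThan sum_power2)
  finally show ?thesis .
qed

text \<open>Codes of nonempty subsets of \<open>{..<q}\<close> lie between 1 and
  \<open>2 ^ q - 1\<close>, a range without distinct congruent numbers. Nonemptiness matters: the
  empty set and \<open>{..<q}\<close> have the congruent codes 0 and
  \<open>2 ^ q - 1\<close>.\<close>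

lemma set_encode_eq_if_cong:
  assumes S: "S \<subseteq> {..<q}" "S \<noteq> {}" and S': "S' \<subseteq> {..<q}" "S' \<noteq> {}"
    and cong: "[int (set_encode S) = int (set_encode S')] (mod (2 ^ q - 1))"
  shows "S = S'"
proof -
  have fin: "finite S" "finite S'"
    using S S' finite_subset by blast+
  have pos: "set_encode S > 0" "set_encode S' > 0"
    using fin S S' by (auto simp: set_encode_def)
  have "int (2 ^ q - 1) = 2 ^ q - 1"
    by (simp add: of_nat_diff)
  with set_encode_le[OF S(1)] set_encode_le[OF S'(1)]
  have le: "int (set_encode S) \<le> 2 ^ q - 1" "int (set_encode S') \<le> 2 ^ q - 1"
    by linarith+
  obtain d where d: "int (set_encode S) - int (set_encode S') = (2 ^ q - 1) * d"
    using cong by (auto simp: cong_iff_dvd_diff)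
  have "\<bar>(2 ^ q - 1) * d\<bar> < (2 ^ q - 1 :: int)"
    using d le pos by linarith
  then have "(2 ^ q - 1) * d = 0"
    using dvd_imp_le_int[of "(2 ^ q - 1) * d" "2 ^ q - 1"] by fastforce
  then have "set_encode S = set_encode S'"
    using d by linarith
  then show ?thesis
    using fin by (simp add: set_encode_eq)
qed

lemma set_encode_pair: "a \<noteq> b \<Longrightarrow> set_encode {a, b} = 2 ^ a + 2 ^ b"
  by (simp add: set_encode_def)

lemma set_encode_triple:
  "a \<noteq> b \<Longrightarrow> a \<noteq> c \<Longrightarrow> b \<noteq> c \<Longrightarrow> set_encode {a, b, c} = 2 ^ a + 2 ^ b + 2 ^ c"
  by (simp add: set_encode_def)

text \<open>Equal summands carry into a single bit, whose position wraps around modulo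
  \<open>q\<close>. The explicit last clause lets the summands be recovered; the cardinality bound
  serves the comparison with three bits.\<close>

lemma set_encode_two_powers:
  fixes q a b :: nat
  assumes "q > 0"
  obtains S where "S \<subseteq> {..<q}" "S \<noteq> {}" "card S \<le> 2"
    "[2 ^ a + 2 ^ b = int (set_encode S)] (mod (2 ^ q - 1))"
    "S = (if a mod q = b mod q then {Suc a mod q} else {a mod q, b mod q})"
proof
  define S where "S = (if a mod q = b mod q then {Suc a mod q} else {a mod q, b mod q})"
  show "S \<subseteq> {..<q}" "S \<noteq> {}" "card S \<le> 2"
    using assms by (auto simp: S_def)
  show "[2 ^ a + 2 ^ b = int (set_encode S)] (mod (2 ^ q - 1))"
  proof (cases "a mod q = b mod q")
    case True
    then have "[2 ^ a + 2 ^ b = 2 ^ a + 2 ^ a] (mod (2 ^ q - 1 :: int))"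
      using cong_power2_if_cong[of b a q] by (intro cong_add) (auto simp: cong_def)
    also have "2 ^ a + 2 ^ a = (2 ^ Suc a :: int)"
      by simp
    also have "[2 ^ Suc a = 2 ^ (Suc a mod q)] (mod (2 ^ q - 1 :: int))"
      by (rule cong_power2_mod)
    finally show ?thesis
      using True by (simp add: S_def set_encode_def)
  next
    case False
    then show ?thesis
      using cong_add[OF cong_power2_mod[of a q] cong_power2_mod[of b q]]
      by (simp add: S_def set_encode_pair)
  qed
qed (rule refl)

text \<open>The two bit sets coincide. Pairs match up to order; singletons arise from carries and
  force all four powers to agree; a pair is never a singleton.\<close>

lemma cong_two_powers2:
  fixes q a b c d :: nat
  assumes "q > 0" and "[2 ^ a + 2 ^ b = 2 ^ c + 2 ^ d] (mod (2 ^ q - 1 :: int))"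
  shows "[2 ^ a = 2 ^ c] (mod (2 ^ q - 1 :: int)) \<and> [2 ^ b = 2 ^ d] (mod (2 ^ q - 1 :: int)) \<or>
         [2 ^ a = 2 ^ d] (mod (2 ^ q - 1 :: int)) \<and> [2 ^ b = 2 ^ c] (mod (2 ^ q - 1 :: int))"
proof -
  obtain S where S: "S \<subseteq> {..<q}" "S \<noteq> {}" "[2 ^ a + 2 ^ b = int (set_encode S)] (mod (2 ^ q - 1))"
    "S = (if a mod q = b mod q then {Suc a mod q} else {a mod q, b mod q})"
    using set_encode_two_powers[OF assms(1)] by metis
  obtain S' where S': "S' \<subseteq> {..<q}" "S' \<noteq> {}" "[2 ^ c + 2 ^ d = int (set_encode S')] (mod (2 ^ q - 1))"
    "S' = (if c mod q = d mod q then {Suc c mod q} else {c mod q, d mod q})"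
    using set_encode_two_powers[OF assms(1)] by metis
  have "S = S'"
    using set_encode_eq_if_cong[OF S(1,2) S'(1,2)] S(3) S'(3) assms(2)
    by (meson cong_sym cong_trans)
  have "Suc a mod q = Suc c mod q \<Longrightarrow> a mod q = c mod q"
    using cong_add_lcancel_nat[of 1 a c q] by (simp add: cong_def)
  then have "a mod q = c mod q \<and> b mod q = d mod q \<or> a mod q = d mod q \<and> b mod q = c mod q"
    using \<open>S = S'\<close> S(4) S'(4) by (auto split: if_splits simp: doubleton_eq_iff)
  then show ?thesis
    by (auto simp: cong_def intro!: cong_power2_if_cong[unfolded cong_def])
qed

text \<open>Three distinct bits cannot form the bit set of the right-hand side, which has at most
  two elements.\<close>

lemma cong_three_powers2:
  fixes q a b c d e :: nat
  assumes "q > 0" and "[2 ^ a + 2 ^ b + 2 ^ c = 2 ^ d + 2 ^ e] (mod (2 ^ q - 1 :: int))"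
  shows "[2 ^ a = 2 ^ b] (mod (2 ^ q - 1 :: int)) \<or> [2 ^ a = 2 ^ c] (mod (2 ^ q - 1 :: int)) \<or>
         [2 ^ b = 2 ^ c] (mod (2 ^ q - 1 :: int))"
proof (rule ccontr)
  assume "\<not> ?thesis"
  then have ne: "a mod q \<noteq> b mod q" "a mod q \<noteq> c mod q" "b mod q \<noteq> c mod q"
    using cong_power2_if_cong unfolding cong_def by blast+
  obtain S where S: "S \<subseteq> {..<q}" "S \<noteq> {}" "card S \<le> 2"
    "[2 ^ d + 2 ^ e = int (set_encode S)] (mod (2 ^ q - 1))"
    using set_encode_two_powers[OF assms(1)] by metis
  have "[2 ^ a + 2 ^ b + 2 ^ c = int (set_encode {a mod q, b mod q, c mod q})] (mod (2 ^ q - 1))"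
    using cong_add[OF cong_add[OF cong_power2_mod[of a q] cong_power2_mod[of b q]]
      cong_power2_mod[of c q]] ne
    by (simp only: set_encode_triple of_nat_add of_nat_power of_nat_numeral not_False_eq_True)
  then have "[int (set_encode {a mod q, b mod q, c mod q}) = int (set_encode S)] (mod (2 ^ q - 1))"
    using S(4) assms(2) by (meson cong_sym cong_trans)
  then have "{a mod q, b mod q, c mod q} = S"
    using S assms(1) by (intro set_encode_eq_if_cong) auto
  with S(3) ne show False
    by auto
qed

section \<open>Latin squares and bitrades\<close>

lemma latin_squareD:
  assumes "latin_square Q L"
  shows "L \<subseteq> Q \<times> Q \<times> Q"
    and "r \<in> Q \<Longrightarrow> c \<in> Q \<Longrightarrow> \<exists>!s. (r, c, s) \<in> L"
    and "r \<in> Q \<Longrightarrow> s \<in> Q \<Longrightarrow> \<exists>!c. (r, c, s) \<in> L"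
    and "c \<in> Q \<Longrightarrow> s \<in> Q \<Longrightarrow> \<exists>!r. (r, c, s) \<in> L"
  using assms by (simp_all add: latin_square_def)

lemma latin_square_cayley_table:
  assumes "group G"
  shows "latin_square (carrier G) (cayley_table G)"
proof -
  interpret group G by fact
  have table: "(r, c, s) \<in> cayley_table G \<longleftrightarrow>
      r \<in> carrier G \<and> c \<in> carrier G \<and> s = r \<otimes>\<^bsub>G\<^esub> c" for r c s
    by (auto simp: cayley_table_def)
  have "\<exists>!c. (r, c, s) \<in> cayley_table G" if "r \<in> carrier G" "s \<in> carrier G" for r s
    using that by (intro ex1I[of _ "inv\<^bsub>G\<^esub> r \<otimes>\<^bsub>G\<^esub> s"]) (auto simp: table m_assoc[symmetric])
  moreover have "\<exists>!r. (r, c, s) \<in> cayley_table G" if "c \<in> carrier G" "s \<in> carrier G" for c s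
    using that by (intro ex1I[of _ "s \<otimes>\<^bsub>G\<^esub> inv\<^bsub>G\<^esub> c"]) (auto simp: table m_assoc)
  moreover have "\<exists>!s. (r, c, s) \<in> cayley_table G" if "r \<in> carrier G" "c \<in> carrier G" for r c
    using that by (simp add: table)
  moreover have "cayley_table G \<subseteq> carrier G \<times> carrier G \<times> carrier G"
    by (auto simp: cayley_table_def)
  ultimately show ?thesis
    unfolding latin_square_def by simp
qed

lemma latin_square_imp_partial_latin_square:
  assumes "latin_square Q L"
  shows "partial_latin_square L"
proof -
  have Q: "r \<in> Q" "c \<in> Q" "s \<in> Q" if "(r, c, s) \<in> L" for r c s
    using assms that by (auto simp: latin_square_def)
  have "s = s'" if "(r, c, s) \<in> L" "(r, c, s') \<in> L" for r c s s'
    using assms that Q[OF that(1)] unfolding latin_square_def by metis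
  moreover have "c = c'" if "(r, c, s) \<in> L" "(r, c', s) \<in> L" for r c s c'
    using assms that Q[OF that(1)] unfolding latin_square_def by metis
  moreover have "r = r'" if "(r, c, s) \<in> L" "(r', c, s) \<in> L" for r c s r'
    using assms that Q[OF that(1)] unfolding latin_square_def by metis
  ultimately show ?thesis
    unfolding partial_latin_square_def by fast
qed

lemma partial_latin_squareD:
  assumes "partial_latin_square P" "(r, c, s) \<in> P" "(r', c', s') \<in> P"
  shows "r = r' \<Longrightarrow> c = c' \<Longrightarrow> s = s'"
    and "r = r' \<Longrightarrow> s = s' \<Longrightarrow> c = c'"
    and "c = c' \<Longrightarrow> s = s' \<Longrightarrow> r = r'"
  using assms unfolding partial_latin_square_def by fastforce+

lemma partial_latin_square_subset:
  "partial_latin_square P \<Longrightarrow> S \<subseteq> P \<Longrightarrow> partial_latin_square S"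
  unfolding partial_latin_square_def split_beta by (meson subsetD)

text \<open>Removing \<open>T\<close> vacates certain row-column, row-symbol and column-symbol
  pairs. The assumptions \<open>rc\<close>, \<open>rs\<close>, \<open>cs\<close> make
  \<open>T'\<close> refill exactly these, and each only once because \<open>T'\<close> is partial
  Latin.\<close>

lemma latin_square_replace:
  assumes L: "latin_square Q L" and T: "T \<subseteq> L" and T': "partial_latin_square T'"
    and rc: "\<And>r c. (\<exists>s. (r, c, s) \<in> T) \<longleftrightarrow> (\<exists>s. (r, c, s) \<in> T')"
    and rs: "\<And>r s. (\<exists>c. (r, c, s) \<in> T) \<longleftrightarrow> (\<exists>c. (r, c, s) \<in> T')"
    and cs: "\<And>c s. (\<exists>r. (r, c, s) \<in> T) \<longleftrightarrow> (\<exists>r. (r, c, s) \<in> T')"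
  shows "latin_square Q ((L - T) \<union> T')"
proof -
  have Q: "L \<subseteq> Q \<times> Q \<times> Q"
    using L by (simp add: latin_square_def)
  have "T' \<subseteq> Q \<times> Q \<times> Q"
  proof
    fix e assume "e \<in> T'"
    obtain r c s where e: "e = (r, c, s)" by (cases e)
    obtain s' where "(r, c, s') \<in> T"
      using \<open>e \<in> T'\<close> e rc[of r c] by auto
    moreover obtain c' where "(r, c', s) \<in> T"
      using \<open>e \<in> T'\<close> e rs[of r s] by auto
    ultimately show "e \<in> Q \<times> Q \<times> Q"
      using T Q e by auto
  qed
  moreover have "\<exists>!s. (r, c, s) \<in> (L - T) \<union> T'" if "r \<in> Q" "c \<in> Q" for r c
  proof -
    have "\<exists>!s. (r, c, s) \<in> L"
      using L that by (simp add: latin_square_def)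
    moreover have "s = s'" if "(r, c, s) \<in> T'" "(r, c, s') \<in> T'" for s s'
      using partial_latin_squareD(1)[OF T' that] by simp
    ultimately show ?thesis
      using rc[of r c] T by blast
  qed
  moreover have "\<exists>!c. (r, c, s) \<in> (L - T) \<union> T'" if "r \<in> Q" "s \<in> Q" for r s
  proof -
    have "\<exists>!c. (r, c, s) \<in> L"
      using L that by (simp add: latin_square_def)
    moreover have "c = c'" if "(r, c, s) \<in> T'" "(r, c', s) \<in> T'" for c c'
      using partial_latin_squareD(2)[OF T' that] by simp
    ultimately show ?thesis
      using rs[of r s] T by blast
  qed
  moreover have "\<exists>!r. (r, c, s) \<in> (L - T) \<union> T'" if "c \<in> Q" "s \<in> Q" for c s
  proof -
    have "\<exists>!r. (r, c, s) \<in> L"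
      using L that by (simp add: latin_square_def)
    moreover have "r = r'" if "(r, c, s) \<in> T'" "(r', c, s) \<in> T'" for r r'
      using partial_latin_squareD(3)[OF T' that] by simp
    ultimately show ?thesis
      using cs[of c s] T by blast
  qed
  ultimately show ?thesis
    using Q unfolding latin_square_def by (intro conjI ballI) auto
qed

text \<open>Take for \<open>s'\<close> the symbol of the new square in this cell. The Cayley table
  has \<open>s'\<close> elsewhere in the same row and column; both entries would clash with the new
  one, so they must have been removed.\<close>

lemma latin_bitrade_alternative_symbol:
  assumes "group G" and U: "latin_bitrade G U U'" and rcs: "(r, c, s) \<in> U"
  obtains s' r' c' where "s' \<noteq> s" "(r, c', s') \<in> U" "(r', c, s') \<in> U"
proof -
  let ?L = "cayley_table G" and ?Q = "carrier G"
  let ?L' = "(?L - U) \<union> U'"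
  have L: "latin_square ?Q ?L"
    using assms(1) by (rule latin_square_cayley_table)
  have L': "latin_square ?Q ?L'" and "U \<subseteq> ?L" and disj: "U \<inter> U' = {}"
    using U by (auto simp: latin_bitrade_def)
  with rcs L have rc: "r \<in> ?Q" "c \<in> ?Q"
    by (auto simp: latin_square_def)
  obtain s' where s': "(r, c, s') \<in> ?L'"
    using latin_squareD(2)[OF L' rc] by (elim ex1E)
  then have "s' \<in> ?Q"
    using latin_squareD(1)[OF L'] by auto
  have "s' \<noteq> s"
    using s' rcs disj by blast
  have pl: "partial_latin_square ?L" "partial_latin_square ?L'"
    using L L' by (auto intro: latin_square_imp_partial_latin_square)
  have "(r, c, s') \<notin> ?L"
    using partial_latin_squareD(1)[OF pl(1)] rcs \<open>U \<subseteq> ?L\<close> \<open>s' \<noteq> s\<close> by blast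
  obtain r' c' where *: "(r, c', s') \<in> ?L" "(r', c, s') \<in> ?L"
    using latin_squareD(3,4)[OF L] rc \<open>s' \<in> ?Q\<close> by metis
  then have ne: "c' \<noteq> c" "r' \<noteq> r"
    using \<open>(r, c, s') \<notin> ?L\<close> by auto
  have "(r, c', s') \<notin> ?L'" "(r', c, s') \<notin> ?L'"
    using partial_latin_squareD(2,3)[OF pl(2) _ s'] ne by blast+
  with * that[OF \<open>s' \<noteq> s\<close>] show thesis
    by blast
qed

section \<open>The trade in exponent form\<close>

text \<open>\<open>E z\<close> plays the role of \<open>u\<^sup>z\<close>, where \<open>u\<close> generates the multiplicative group and
  \<open>1 + u\<close> is \<open>u\<close> to the power \<open>2 N - 1\<close>; of the field structure, only the sums in the assumption
  \<open>E_mult\<close> are needed.\<close>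

locale mersenne_trade =
  fixes G :: "('a, 'm) monoid_scheme" and E :: "int \<Rightarrow> 'a" and q j :: nat
    and P N :: int
  defines "P \<equiv> 2 ^ q - 1" and "N \<equiv> 2 ^ j"
  assumes group_G: "group G"
    and prime_P: "Factorial_Ring.prime (2 ^ q - 1 :: nat)"
    and E_closed: "E z \<in> carrier G"
    and E_eq_iff: "E z = E w \<longleftrightarrow> [z = w] (mod P)"
    and E_mult: "E z \<otimes>\<^bsub>G\<^esub> E (z + (2 * N - 1) * 2 ^ k) = E (z + 2 ^ k)"
    and N_ncong_1: "\<not> [N = 1] (mod P)"
    and N_ncong_half: "\<not> [2 * N = 1] (mod P)"
begin

section \<open>Arithmetic modulo the prime \<open>P\<close>\<close>

lemma prime_int_P: "Factorial_Ring.prime P"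
proof -
  have "int (2 ^ q - 1) = P"
    by (simp add: P_def of_nat_diff)
  then show ?thesis
    using prime_P by (metis prime_nat_int_transfer)
qed

lemma prime_q: "Factorial_Ring.prime q"
  using prime_P by (rule prime_exponent_of_mersenne_prime)

lemma q_pos: "q > 0"
  using prime_q by (rule prime_gt_0_nat)

lemma coprime_P:
  assumes "\<not> [x = 0] (mod P)"
  shows "coprime x P"
  using assms prime_int_P
  by (metis cong_0_iff coprime_commute prime_imp_coprime_int)

lemma cancel_factor:
  assumes "\<not> [c = 0] (mod P)"
  shows "[c * x = c * y] (mod P) \<longleftrightarrow> [x = y] (mod P)"
  using coprime_P[OF assms] by (rule cong_mult_lcancel)

lemma power2_ncong_0: "\<not> [2 ^ k = 0] (mod P)"
proof
  assume "[2 ^ k = 0] (mod P)"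
  then have "P dvd 2"
    using prime_int_P by (auto simp: cong_0_iff dest: prime_dvd_power)
  moreover have "odd P"
    using q_pos by (simp add: P_def)
  ultimately show False
    using prime_int_P primes_dvd_imp_eq[of P 2] by auto
qed

lemma cancel_power2: "[2 ^ k * x = 2 ^ k * y] (mod P) \<longleftrightarrow> [x = y] (mod P)"
  using power2_ncong_0 by (rule cancel_factor)

lemma cancel_2: "[2 * x = 2 * y] (mod P) \<longleftrightarrow> [x = y] (mod P)"
  using cancel_power2[of 1] by simp

lemma cancel_N: "[N * x = N * y] (mod P) \<longleftrightarrow> [x = y] (mod P)"
  unfolding N_def by (rule cancel_power2)

lemma ncong_0:
  "\<not> [2 * N - 1 = 0] (mod P)" "\<not> [N - 1 = 0] (mod P)"
  using N_ncong_half N_ncong_1 by (auto simp: cong_iff_dvd_diff)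

lemma cong_add_cancel:
  fixes z w x y :: int
  assumes "[z = w] (mod P)"
  shows "[z + x = w + y] (mod P) \<longleftrightarrow> [x = y] (mod P)"
  using cong_diff[OF _ assms, of "z + x" "w + y"] cong_add[OF assms, of x y] by auto

lemma cong_power2_period: "[k = l] (mod q) \<Longrightarrow> [2 ^ k = 2 ^ l] (mod P)"
  unfolding P_def by (rule cong_power2_if_cong)

lemma power2_inj:
  assumes "k < q" "l < q" "[2 ^ k = 2 ^ l] (mod P)"
  shows "k = l"
proof -
  have "{k} = {l}"
    using assms by (intro set_encode_eq_if_cong[of _ q]) (auto simp: P_def set_encode_def)
  then show ?thesis by simp
qed

section \<open>The trade and its disjoint mate\<close>

definition entry :: "int \<Rightarrow> nat \<Rightarrow> 'a \<times> 'a \<times> 'a" where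
  "entry z k = (E z, E (z + (2 * N - 1) * 2 ^ k), E (z + 2 ^ k))"

definition mate :: "int \<Rightarrow> nat \<Rightarrow> 'a \<times> 'a \<times> 'a" where
  "mate z k = (E z, E (z + (2 * N - 1) * 2 ^ k), E (z + N * 2 ^ k))"

definition T :: "('a \<times> 'a \<times> 'a) set" where
  "T = {entry z k | z k. True}"

definition T' :: "('a \<times> 'a \<times> 'a) set" where
  "T' = {mate z k | z k. True}"

lemma entry_eq_iff: "entry z k = entry w l \<longleftrightarrow> [z = w] (mod P) \<and> [2 ^ k = 2 ^ l] (mod P)"
  by (auto simp: entry_def E_eq_iff cong_add_cancel cancel_factor[OF ncong_0(1)])

lemma mate_eq_iff: "mate z k = mate w l \<longleftrightarrow> [z = w] (mod P) \<and> [2 ^ k = 2 ^ l] (mod P)"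
  by (auto simp: mate_def E_eq_iff cong_add_cancel cancel_factor[OF ncong_0(1)] cancel_N)

lemma T_subset: "T \<subseteq> cayley_table G"
  using E_closed E_mult by (auto simp: T_def entry_def cayley_table_def)

lemma partial_latin_square_T: "partial_latin_square T"
  using latin_square_imp_partial_latin_square[OF latin_square_cayley_table[OF group_G]] T_subset
  by (rule partial_latin_square_subset)

text \<open>\<open>T'\<close> inherits nothing from the Cayley table, so each pair of coordinates
  must be shown to determine both indices. This works because \<open>2 * N - 1\<close>,
  \<open>N\<close> and \<open>N - 1\<close> are invertible modulo \<open>P\<close>.\<close>

lemma mate_eqI:
  assumes "mate z k = (r, c, s)" "mate w l = (r', c', s')"
    and "r = r' \<and> c = c' \<or> r = r' \<and> s = s' \<or> c = c' \<and> s = s'"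
  shows "mate z k = mate w l"
  using assms(3)
proof (elim disjE)
  assume "r = r' \<and> c = c'"
  then have "E z = E w" "E (z + (2 * N - 1) * 2 ^ k) = E (w + (2 * N - 1) * 2 ^ l)"
    using assms(1,2) by (auto simp: mate_def)
  then show ?thesis
    by (simp add: E_eq_iff mate_eq_iff cong_add_cancel cancel_factor[OF ncong_0(1)])
next
  assume "r = r' \<and> s = s'"
  then have "E z = E w" "E (z + N * 2 ^ k) = E (w + N * 2 ^ l)"
    using assms(1,2) by (auto simp: mate_def)
  then show ?thesis
    by (simp add: E_eq_iff mate_eq_iff cong_add_cancel cancel_N)
next
  assume "c = c' \<and> s = s'"
  then have "E (z + (2 * N - 1) * 2 ^ k) = E (w + (2 * N - 1) * 2 ^ l)"
    "E (z + N * 2 ^ k) = E (w + N * 2 ^ l)"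
    using assms(1,2) by (auto simp: mate_def)
  then have *: "[z + (2 * N - 1) * 2 ^ k = w + (2 * N - 1) * 2 ^ l] (mod P)"
    "[z + N * 2 ^ k = w + N * 2 ^ l] (mod P)"
    by (simp_all only: E_eq_iff)
  \<comment> \<open>Column exponent minus symbol exponent is free of the row.\<close>
  from cong_diff[OF *] have "[(N - 1) * 2 ^ k = (N - 1) * 2 ^ l] (mod P)"
    by (simp add: algebra_simps)
  then have kl: "[2 ^ k = 2 ^ l] (mod P)"
    by (simp add: cancel_factor[OF ncong_0(2)])
  then have "[N * 2 ^ k = N * 2 ^ l] (mod P)"
    by (simp add: cancel_N)
  from cong_diff[OF *(2) this] have "[z = w] (mod P)"
    by simp
  with kl show ?thesis
    by (simp add: mate_eq_iff)
qed

lemma partial_latin_square_T': "partial_latin_square T'"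
  unfolding partial_latin_square_def T'_def by clarsimp (metis mate_eqI prod.inject)

text \<open>A shared entry has the same cell, hence the same power of 2, in both families; equal
  symbols then make \<open>N\<close> congruent to 1.\<close>

lemma T_T'_disjoint: "T \<inter> T' = {}"
proof -
  have False if "entry z k = mate w l" for z k w l
  proof -
    from that have "[2 ^ k = 2 ^ l] (mod P)" "[2 ^ k = N * 2 ^ l] (mod P)"
      by (auto simp: entry_def mate_def E_eq_iff cong_add_cancel cancel_factor[OF ncong_0(1)])
    then have "[2 ^ l * N = 2 ^ l * 1] (mod P)"
      by (metis cong_sym cong_trans mult.commute mult.right_neutral)
    then show False
      using N_ncong_1 by (simp only: cancel_power2)
  qed
  then show ?thesis
    unfolding T_def T'_def by blast
qed

lemma index_representative:
  obtains w l where "(w, l) \<in> {0..<P} \<times> {..<q}" "[z = w] (mod P)" "[2 ^ k = 2 ^ l] (mod P)"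
proof
  show "(z mod P, k mod q) \<in> {0..<P} \<times> {..<q}"
    using q_pos prime_gt_0_int[OF prime_int_P] by simp
  show "[z = z mod P] (mod P)"
    by (simp add: cong_def)
  show "[2 ^ k = 2 ^ (k mod q)] (mod P)"
    by (rule cong_power2_period) (simp add: cong_def)
qed

lemma index_unique:
  assumes "(z, k) \<in> {0..<P} \<times> {..<q}" "(w, l) \<in> {0..<P} \<times> {..<q}"
    "[z = w] (mod P)" "[2 ^ k = 2 ^ l] (mod P)"
  shows "(z, k) = (w, l)"
  using assms power2_inj[of k l] by (auto simp: cong_def)

lemma card_indexed_family:
  fixes f :: "int \<Rightarrow> nat \<Rightarrow> 'b"
  assumes f: "\<And>z k w l. f z k = f w l \<longleftrightarrow> [z = w] (mod P) \<and> [2 ^ k = 2 ^ l] (mod P)"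
  shows "card {f z k | z k. True} = nat P * q"
proof -
  have "{f z k | z k. True} = (\<lambda>(z, k). f z k) ` ({0..<P} \<times> {..<q})"
  proof (intro equalityI subsetI)
    fix e assume "e \<in> {f z k | z k. True}"
    then obtain z k where e: "e = f z k"
      by blast
    obtain w l where wl: "(w, l) \<in> {0..<P} \<times> {..<q}" "[z = w] (mod P)" "[2 ^ k = 2 ^ l] (mod P)"
      by (rule index_representative)
    then have "e = (\<lambda>(z, k). f z k) (w, l)"
      by (simp add: e f)
    with wl(1) show "e \<in> (\<lambda>(z, k). f z k) ` ({0..<P} \<times> {..<q})"
      by (rule rev_image_eqI)
  qed auto
  moreover have "inj_on (\<lambda>(z, k). f z k) ({0..<P} \<times> {..<q})"
    using index_unique by (auto simp: inj_on_def f)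
  ultimately show ?thesis
    by (simp add: card_image)
qed

lemma card_T: "card T = nat P * q"
  unfolding T_def using entry_eq_iff by (rule card_indexed_family)

lemma card_T': "card T' = nat P * q"
  unfolding T'_def using mate_eq_iff by (rule card_indexed_family)

lemma same_row_column: "(\<exists>s. (r, c, s) \<in> T) \<longleftrightarrow> (\<exists>s. (r, c, s) \<in> T')"
  by (auto simp: T_def T'_def entry_def mate_def)

lemma same_row_symbol: "(\<exists>c. (r, c, s) \<in> T) \<longleftrightarrow> (\<exists>c. (r, c, s) \<in> T')"
proof
  assume "\<exists>c. (r, c, s) \<in> T"
  then obtain z k where r: "r = E z" and s: "s = E (z + 2 ^ k)"
    by (auto simp: T_def entry_def)
  \<comment> \<open>This is \<open>k - j\<close> modulo \<open>q\<close>, written without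
    subtraction, so that \<open>N * 2 ^ l\<close> is \<open>2 ^ k\<close>.\<close>
  define l where "l = k + j * (q - 1)"
  have "j + l = k + j * q"
    using q_pos by (cases q) (auto simp: l_def)
  then have "[j + l = k] (mod q)"
    by (simp add: cong_def)
  then have "[N * 2 ^ l = 2 ^ k] (mod P)"
    unfolding N_def power_add[symmetric] by (rule cong_power2_period)
  then have "(r, E (z + (2 * N - 1) * 2 ^ l), s) = mate z l"
    unfolding r s mate_def by (simp add: E_eq_iff cong_add_cancel cong_sym)
  then show "\<exists>c. (r, c, s) \<in> T'"
    unfolding T'_def by blast
next
  assume "\<exists>c. (r, c, s) \<in> T'"
  then obtain z k where r: "r = E z" and s: "s = E (z + N * 2 ^ k)"
    by (auto simp: T'_def mate_def)
  then have "(r, E (z + (2 * N - 1) * 2 ^ (j + k)), s) = entry z (j + k)"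
    by (simp add: entry_def N_def power_add)
  then show "\<exists>c. (r, c, s) \<in> T"
    unfolding T_def by blast
qed

lemma same_column_symbol: "(\<exists>r. (r, c, s) \<in> T) \<longleftrightarrow> (\<exists>r. (r, c, s) \<in> T')"
proof
  assume "\<exists>r. (r, c, s) \<in> T"
  then obtain z k where "c = E (z + (2 * N - 1) * 2 ^ k)" "s = E (z + 2 ^ k)"
    by (auto simp: T_def entry_def)
  \<comment> \<open>Moving the row back by \<open>(2 * N - 1) * 2 ^ k\<close> while doubling the
    power keeps the column, and turns the symbol exponent of the mate into
    \<open>z + 2 ^ k\<close>.\<close>
  then have "(E (z - (2 * N - 1) * 2 ^ k), c, s) = mate (z - (2 * N - 1) * 2 ^ k) (Suc k)"
    by (simp add: mate_def algebra_simps)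
  then show "\<exists>r. (r, c, s) \<in> T'"
    unfolding T'_def by blast
next
  assume "\<exists>r. (r, c, s) \<in> T'"
  then obtain z k where c: "c = E (z + (2 * N - 1) * 2 ^ k)" and s: "s = E (z + N * 2 ^ k)"
    by (auto simp: T'_def mate_def)
  \<comment> \<open>Conversely the power is halved: \<open>l\<close> is \<open>k - 1\<close> modulo
    \<open>q\<close>, and \<open>w\<close> is chosen to keep the column exponent.\<close>
  define l where "l = k + (q - 1)"
  define w where "w = z + (2 * N - 1) * (2 ^ k - 2 ^ l)"
  have "Suc l = k + q"
    using q_pos by (simp add: l_def)
  then have "[2 ^ Suc l = 2 ^ k] (mod P)"
    by (intro cong_power2_period) (simp add: cong_def)
  then have "[2 * 2 ^ l = 2 ^ k] (mod P)"
    by simp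
  then have "P dvd (2 * 2 ^ l - 2 ^ k) * (1 - N)"
    by (simp add: cong_iff_dvd_diff)
  also have "(2 * 2 ^ l - 2 ^ k) * (1 - N) = (w + 2 ^ l) - (z + N * 2 ^ k)"
    by (simp add: w_def algebra_simps)
  finally have "E (w + 2 ^ l) = s"
    by (simp add: s E_eq_iff cong_iff_dvd_diff)
  moreover have "E (w + (2 * N - 1) * 2 ^ l) = c"
    by (simp add: c w_def algebra_simps)
  ultimately have "(E w, c, s) = entry w l"
    by (simp add: entry_def)
  then show "\<exists>r. (r, c, s) \<in> T"
    unfolding T_def by blast
qed

lemma latin_bitrade_T: "latin_bitrade G T T'"
proof -
  have "entry 0 0 \<in> T"
    by (auto simp: T_def)
  then show ?thesis
    unfolding latin_bitrade_def
    using T_subset partial_latin_square_T partial_latin_square_T' card_T card_T' T_T'_disjoint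
      latin_square_replace[OF latin_square_cayley_table[OF group_G] T_subset
        partial_latin_square_T' same_row_column same_row_symbol same_column_symbol]
    by auto
qed

lemma homogeneous_T: "homogeneous q T"
proof -
  have card_entries: "card ((\<lambda>k. entry (f k) k) ` {..<q}) = q" for f
  proof -
    have "inj_on (\<lambda>k. entry (f k) k) {..<q}"
      using power2_inj by (auto simp: inj_on_def entry_eq_iff)
    then show ?thesis
      by (simp add: card_image)
  qed
  \<comment> \<open>Rows, columns and symbols together: \<open>g\<close> picks a coordinate with
    exponent \<open>z + d k\<close>, so the line of \<open>E w\<close> has exactly one entry for
    each \<open>k < q\<close>, with row exponent \<open>w - d k\<close>.\<close>
  have line: "card {e \<in> T. g e = x} \<in> {0, q}"
    if g: "\<And>z k. g (entry z k) = E (z + d k)"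
      and d: "\<And>k l. [2 ^ k = 2 ^ l] (mod P) \<Longrightarrow> [d k = d l] (mod P)"
    for g :: "'a \<times> 'a \<times> 'a \<Rightarrow> 'a" and d x
  proof (cases "x \<in> range E")
    case False
    then have "{e \<in> T. g e = x} = {}"
      by (auto simp: T_def g)
    then show ?thesis
      by (simp only: card.empty insertI1)
  next
    case True
    then obtain w where w: "x = E w"
      by blast
    have "{e \<in> T. g e = x} = (\<lambda>k. entry (w - d k) k) ` {..<q}"
    proof (intro equalityI subsetI)
      fix e assume "e \<in> {e \<in> T. g e = x}"
      then obtain z k where e: "e = entry z k" and zk: "[z + d k = w] (mod P)"
        by (auto simp: T_def g w E_eq_iff)
      obtain l where l: "l < q" "[2 ^ k = 2 ^ l] (mod P)"
        using index_representative[of z k] by auto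
      have "[z = w - d l] (mod P)"
        using cong_diff[OF zk d[OF l(2)]] by simp
      then show "e \<in> (\<lambda>k. entry (w - d k) k) ` {..<q}"
        using e l by (auto simp: entry_eq_iff)
    next
      fix e assume "e \<in> (\<lambda>k. entry (w - d k) k) ` {..<q}"
      then show "e \<in> {e \<in> T. g e = x}"
        by (auto simp: T_def g w)
    qed
    then show ?thesis
      by (simp only: card_entries insert_iff simp_thms)
  qed
  have "card {e \<in> T. fst e = x} \<in> {0, q}" for x
    by (rule line[of _ "\<lambda>_. 0"]) (auto simp: entry_def)
  moreover have "card {e \<in> T. fst (snd e) = x} \<in> {0, q}" for x
    by (rule line[of _ "\<lambda>k. (2 * N - 1) * 2 ^ k"])
      (auto simp: entry_def cancel_factor[OF ncong_0(1)])
  moreover have "card {e \<in> T. snd (snd e) = x} \<in> {0, q}" for x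
    by (rule line[of _ "\<lambda>k. 2 ^ k"]) (auto simp: entry_def)
  moreover have "{(r, c, s) \<in> T. r = x} = {e \<in> T. fst e = x}"
    "{(r, c, s) \<in> T. c = x} = {e \<in> T. fst (snd e) = x}"
    "{(r, c, s) \<in> T. s = x} = {e \<in> T. snd (snd e) = x}" for x
    by auto
  ultimately show ?thesis
    by (simp only: homogeneous_def simp_thms)
qed

section \<open>Minimality\<close>

text \<open>A cell of \<open>T\<close> admits just one other symbol that \<open>T\<close> uses both in its row and in its column:
  a sum of three powers of 2 that is congruent to a sum of two has a repeated summand.\<close>

lemma alternative_symbol_unique:
  assumes "[2 ^ l + 2 * N * 2 ^ t + 2 ^ k = 2 * N * 2 ^ k + 2 * 2 ^ t] (mod P)"
    and "\<not> [2 ^ l = 2 ^ k] (mod P)"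
  shows "[2 ^ l = N * 2 ^ k] (mod P) \<and> [2 * 2 ^ t = 2 ^ k] (mod P)"
proof -
  have pow: "2 * N * 2 ^ i = 2 ^ (Suc j + i)" "2 * 2 ^ i = (2 :: int) ^ Suc i" for i
    by (simp_all add: N_def power_add)
  note two = cong_two_powers2[OF q_pos, folded P_def]
  have M: "\<not> [2 * N * 2 ^ i = 2 ^ i] (mod P)" "\<not> [2 ^ i = 2 * N * 2 ^ i] (mod P)" for i
    using N_ncong_half cancel_power2[of i "2 * N" 1] by (auto simp: mult.commute cong_sym)
  \<comment> \<open>The remaining coincidence, of \<open>2 ^ l\<close> with \<open>2 ^ k\<close>, is
    excluded by assumption.\<close>
  consider "[2 ^ l = 2 * N * 2 ^ t] (mod P)" | "[2 * N * 2 ^ t = 2 ^ k] (mod P)"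
    using cong_three_powers2[OF q_pos, folded P_def, of l "Suc j + t" k "Suc j + k" "Suc t"] assms
    unfolding pow by blast
  then show ?thesis
  proof cases
    case 1
    then have "[2 * 2 ^ l + 2 ^ k = 2 ^ l + 2 * N * 2 ^ t + 2 ^ k] (mod P)"
      unfolding mult_2 by (intro cong_add cong_refl)
    also note assms(1)
    finally have "[2 ^ Suc l + 2 ^ k = 2 ^ (Suc j + k) + 2 ^ Suc t] (mod P)"
      unfolding pow .
    \<comment> \<open>The first matching is the claim. The second would make \<open>2 ^ t\<close>
      fixed under multiplication by \<open>2 * N\<close>.\<close>
    from two[OF this] consider
      "[2 * 2 ^ l = 2 * N * 2 ^ k] (mod P)" "[2 ^ k = 2 * 2 ^ t] (mod P)" |
      "[2 * 2 ^ l = 2 * 2 ^ t] (mod P)"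
      unfolding pow by blast
    then show ?thesis
    proof cases
      case a: 1
      then show ?thesis
        by (simp add: mult.assoc cancel_2 cong_sym)
    next
      case 2
      then have "[2 ^ l = 2 ^ t] (mod P)"
        by (simp add: cancel_2)
      then show ?thesis
        using 1 M(2)[of t] by (metis cong_sym cong_trans)
    qed
  next
    case 2
    \<comment> \<open>This coincidence is impossible: one matching makes \<open>2 * N\<close>, the
      other \<open>N\<close>, congruent to 1.\<close>
    then have "[2 ^ l + 2 * N * 2 ^ t + 2 ^ k = 2 ^ l + 2 ^ k + 2 ^ k] (mod P)"
      by (intro cong_add cong_refl)
    then have "[2 ^ l + 2 * 2 ^ k = 2 ^ l + 2 * N * 2 ^ t + 2 ^ k] (mod P)"
      by (metis add.assoc cong_sym mult_2)
    also note assms(1)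
    finally have "[2 ^ l + 2 ^ Suc k = 2 ^ (Suc j + k) + 2 ^ Suc t] (mod P)"
      unfolding pow .
    from two[OF this] consider
      "[2 * 2 ^ k = 2 * 2 ^ t] (mod P)" | "[2 * 2 ^ k = 2 * N * 2 ^ k] (mod P)"
      unfolding pow by blast
    then show ?thesis
    proof cases
      case a: 1
      then have "[2 ^ k = 2 ^ t] (mod P)"
        by (simp add: cancel_2)
      then show ?thesis
        using 2 M(1)[of t] by (metis cong_sym cong_trans)
    next
      case a: 2
      then have "[2 ^ k = N * 2 ^ k] (mod P)"
        unfolding mult.assoc cancel_2 .
      then have "[2 ^ k * 1 = 2 ^ k * N] (mod P)"
        by (simp add: mult.commute)
      then have "[1 = N] (mod P)"
        by (simp only: cancel_power2)
      then show ?thesis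
        using N_ncong_1 by (simp add: cong_sym)
    qed
  qed
qed

text \<open>The alternative symbol of the cell occurs in its row at the power
  \<open>N * 2 ^ k\<close>, and in its column at half the power \<open>2 ^ k\<close>; both entries
  lie in \<open>U\<close>. The premise on \<open>t\<close> expresses the halving without
  division.\<close>

lemma sub_bitrade_step:
  assumes U: "latin_bitrade G U U'" "U \<subseteq> T" and zk: "entry z k \<in> U"
  shows "entry z (j + k) \<in> U"
    and "[2 * 2 ^ t = 2 ^ k] (mod P) \<Longrightarrow> entry (z + (2 * N - 1) * 2 ^ t) t \<in> U"
proof -
  obtain s r c where s: "s \<noteq> E (z + 2 ^ k)" and
    row: "(E z, c, s) \<in> U" and col: "(r, E (z + (2 * N - 1) * 2 ^ k), s) \<in> U"
    using latin_bitrade_alternative_symbol[OF group_G U(1) zk[unfolded entry_def]] by metis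
  obtain z' l where row': "(E z, c, s) = entry z' l"
    using row U(2) by (auto simp: T_def)
  then have z': "[z = z'] (mod P)"
    by (simp add: entry_def E_eq_iff)
  have sl: "s = E (z + 2 ^ l)"
    using row' z' by (auto simp: entry_def E_eq_iff cong_add_cancel cong_sym)
  have row_entry: "entry z l \<in> U"
    using row row' z' by (simp add: entry_eq_iff cong_sym)
      (metis entry_eq_iff cong_refl)
  obtain w i where col': "(r, E (z + (2 * N - 1) * 2 ^ k), s) = entry w i"
    using col U(2) by (auto simp: T_def)
  then have c: "[z + (2 * N - 1) * 2 ^ k = w + (2 * N - 1) * 2 ^ i] (mod P)"
    and "[z + 2 ^ l = w + 2 ^ i] (mod P)"
    by (auto simp: entry_def E_eq_iff sl)
  from cong_diff[OF this(2,1)]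
  have "[2 ^ l - (2 * N - 1) * 2 ^ k = 2 ^ i - (2 * N - 1) * 2 ^ i] (mod P)"
    by simp
  \<comment> \<open>Adding this term leaves only sums of powers of 2 on both sides.\<close>
  then have "[2 ^ l - (2 * N - 1) * 2 ^ k + 2 * N * (2 ^ k + 2 ^ i) =
    2 ^ i - (2 * N - 1) * 2 ^ i + 2 * N * (2 ^ k + 2 ^ i)] (mod P)"
    by (intro cong_add cong_refl)
  then have "[2 ^ l + 2 * N * 2 ^ i + 2 ^ k = 2 * N * 2 ^ k + 2 * 2 ^ i] (mod P)"
    by (simp add: algebra_simps)
  moreover have "\<not> [2 ^ l = 2 ^ k] (mod P)"
    using s sl by (simp add: E_eq_iff cong_add_cancel)
  ultimately have l: "[2 ^ l = N * 2 ^ k] (mod P)" and i: "[2 * 2 ^ i = 2 ^ k] (mod P)"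
    using alternative_symbol_unique by blast+
  have "entry z l = entry z (j + k)"
    using l by (simp add: entry_eq_iff N_def power_add)
  with row_entry show "entry z (j + k) \<in> U"
    by simp
  assume "[2 * 2 ^ t = 2 ^ k] (mod P)"
  with i have "[2 * 2 ^ i = 2 * 2 ^ t] (mod P)"
    by (metis cong_sym cong_trans)
  then have it: "[2 ^ i = 2 ^ t] (mod P)"
    by (simp add: cancel_2)
  have "[(2 * N - 1) * (2 * 2 ^ i) = (2 * N - 1) * 2 ^ k] (mod P)"
    using i by (simp only: cancel_factor[OF ncong_0(1)])
  from cong_diff[OF c cong_sym[OF this]] have "[z = w - (2 * N - 1) * 2 ^ i] (mod P)"
    by (simp add: algebra_simps)
  moreover have "[(2 * N - 1) * 2 ^ t = (2 * N - 1) * 2 ^ i] (mod P)"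
    using it by (simp only: cancel_factor[OF ncong_0(1)] cong_sym)
  ultimately have "[z + (2 * N - 1) * 2 ^ t = w - (2 * N - 1) * 2 ^ i + (2 * N - 1) * 2 ^ i] (mod P)"
    by (rule cong_add)
  then have "entry (z + (2 * N - 1) * 2 ^ t) t = entry w i"
    using it by (simp add: entry_eq_iff cong_sym)
  with col col' show "entry (z + (2 * N - 1) * 2 ^ t) t \<in> U"
    by simp
qed

text \<open>Within a row the index can be raised by \<open>j\<close> repeatedly. As \<open>N\<close>
  is not 1, the prime \<open>q\<close> does not divide \<open>j\<close>, so every index modulo
  \<open>q\<close> is reached.\<close>

lemma sub_bitrade_full_row:
  assumes U: "latin_bitrade G U U'" "U \<subseteq> T" and zk: "entry z k \<in> U"
  shows "entry z l \<in> U"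
proof -
  have iter: "entry z (k + m * j) \<in> U" for m
  proof (induction m)
    case (Suc m)
    from sub_bitrade_step(1)[OF U this] show ?case
      by (simp add: ac_simps)
  qed (use zk in simp)
  have "\<not> q dvd j"
    using cong_power2_period[of j 0] N_ncong_1 by (auto simp: N_def cong_def)
  then have "coprime j q"
    using prime_q by (metis coprime_commute prime_imp_coprime_nat)
  then obtain x where x: "[j * x = 1] (mod q)"
    using cong_solve_coprime_nat[of j q] by auto
  \<comment> \<open>The solution of \<open>k + m * j = l\<close> modulo \<open>q\<close>, with
    \<open>(q - 1) * k\<close> standing for \<open>- k\<close>.\<close>
  define m where "m = x * (l + (q - 1) * k)"
  have "[j * x * (l + (q - 1) * k) = 1 * (l + (q - 1) * k)] (mod q)"
    using x by (intro cong_mult cong_refl)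
  then have "[k + m * j = k + (l + (q - 1) * k)] (mod q)"
    by (simp add: m_def ac_simps cong_add_lcancel_nat)
  also have "k + (l + (q - 1) * k) = l + q * k"
    using q_pos by (cases q) auto
  also have "[l + q * k = l] (mod q)"
    by (simp add: cong_def)
  finally have "entry z (k + m * j) = entry z l"
    by (simp add: entry_eq_iff cong_power2_period)
  with iter[of m] show ?thesis
    by simp
qed

lemma sub_bitrade_eq:
  assumes U: "latin_bitrade G U U'" "U \<subseteq> T"
  shows "U = T"
proof -
  have "U \<noteq> {}"
    using U(1) by (simp add: latin_bitrade_def)
  with U(2) obtain z k where zk: "entry z k \<in> U"
    unfolding T_def by blast
  have iter: "entry (z + int m * (2 * N - 1)) 0 \<in> U" for m
  proof (induction m)
    case 0
    show ?case
      using sub_bitrade_full_row[OF U zk, of 0] by simp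
  next
    case (Suc m)
    \<comment> \<open>Index 1 is chosen so that halving leads to index 0 and shifts the row by
      exactly \<open>2 * N - 1\<close>.\<close>
    have "entry (z + int m * (2 * N - 1)) 1 \<in> U"
      using sub_bitrade_full_row[OF U Suc] .
    from sub_bitrade_step(2)[OF U this, of 0] show ?case
      by (simp add: algebra_simps)
  qed
  have "entry w l \<in> U" for w l
  proof -
    \<comment> \<open>Since \<open>2 * N - 1\<close> is invertible modulo \<open>P\<close>, repeated
      shifts reach the row \<open>w\<close>; \<open>m\<close> is the number of shifts.\<close>
    obtain x where x: "[(2 * N - 1) * x = 1] (mod P)"
      using cong_solve_coprime_int[OF coprime_P[OF ncong_0(1)]] by blast
    define m where "m = nat ((x * (w - z)) mod P)"
    have "int m = (x * (w - z)) mod P"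
      using prime_gt_0_int[OF prime_int_P] by (simp add: m_def)
    then have "[int m = x * (w - z)] (mod P)"
      by (simp add: cong_def)
    then have "[z + int m * (2 * N - 1) = z + x * (w - z) * (2 * N - 1)] (mod P)"
      by (intro cong_add cong_mult cong_refl)
    also have "z + x * (w - z) * (2 * N - 1) = z + (2 * N - 1) * x * (w - z)"
      by (simp add: ac_simps)
    also have "[\<dots> = z + 1 * (w - z)] (mod P)"
      using x by (intro cong_add cong_mult cong_refl)
    finally have "entry (z + int m * (2 * N - 1)) 0 = entry w 0"
      by (simp add: entry_eq_iff)
    with iter[of m] show ?thesis
      using sub_bitrade_full_row[OF U] by metis
  qed
  then show ?thesis
    using U(2) by (auto simp: T_def)
qed

lemma minimal_latin_trade_T: "minimal_latin_trade G T"
  unfolding minimal_latin_trade_def latin_trade_def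
  using latin_bitrade_T sub_bitrade_eq by blast

end

section \<open>Elementary abelian 2-groups\<close>

lemma group_Z2_power: "group (Z2_power n)"
  by (simp add: Z2_power_def)

lemma carrier_Z2_power: "carrier (Z2_power n) = {..<n} \<rightarrow>\<^sub>E {0..<2}"
  by (simp add: Z2_power_def carrier_integer_mod_group)

lemma mult_Z2_power: "x \<otimes>\<^bsub>Z2_power n\<^esub> y = (\<lambda>k\<in>{..<n}. (x k + y k) mod 2)"
  by (simp add: Z2_power_def)

lemma card_carrier_Z2_power: "card (carrier (Z2_power n)) = 2 ^ n"
  by (simp add: carrier_Z2_power card_PiE)

text \<open>An embedding for \<open>n\<close> has an image too small to exhaust the group; sending
  the new basis vector to some \<open>g\<close> outside it extends the embedding. The inequality on
  the order, unlike an equation, survives the induction.\<close>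

lemma (in comm_group) elementary_abelian_embedding:
  assumes sq: "\<And>x. x \<in> carrier G \<Longrightarrow> x \<otimes> x = \<one>"
    and "2 ^ n \<le> order G"
  shows "\<exists>h \<in> hom (Z2_power n) G. inj_on h (carrier (Z2_power n))"
  using assms(2)
proof (induction n)
  case 0
  show ?case
    by (intro bexI[of _ "\<lambda>_. \<one>"]) (auto simp: hom_def carrier_Z2_power)
next
  case (Suc n)
  then obtain h where h: "h \<in> hom (Z2_power n) G" "inj_on h (carrier (Z2_power n))"
    by auto
  have "card (h ` carrier (Z2_power n)) = 2 ^ n"
    using h(2) by (simp add: card_image card_carrier_Z2_power)
  moreover have "(2 :: nat) ^ n < 2 ^ Suc n"
    by simp
  ultimately have "h ` carrier (Z2_power n) \<noteq> carrier G"
    using Suc.prems by (auto simp: order_def)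
  moreover have "h ` carrier (Z2_power n) \<subseteq> carrier G"
    using h(1) by (auto simp: hom_def)
  ultimately obtain g where g: "g \<in> carrier G" "g \<notin> h ` carrier (Z2_power n)"
    by blast
  define r where "r x = restrict x {..<n}" for x :: "nat \<Rightarrow> int"
  define d where "d x = (if x n = 0 then \<one> else g)" for x :: "nat \<Rightarrow> int"
  have r: "r x \<in> carrier (Z2_power n)" if "x \<in> carrier (Z2_power (Suc n))" for x
    using that by (auto simp: r_def carrier_Z2_power PiE_def Pi_def)
  have last: "x n = 0 \<or> x n = 1" if "x \<in> carrier (Z2_power (Suc n))" for x
  proof -
    have "x n \<in> {0..<2}"
      using that unfolding carrier_Z2_power by (rule PiE_mem) simp
    then show ?thesis by auto
  qed
  have hr: "h (r x) \<in> carrier G" if "x \<in> carrier (Z2_power (Suc n))" for x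
    using r[OF that] h(1) by (auto simp: hom_def)
  have d: "d x \<in> carrier G" for x
    using g by (simp add: d_def)
  have "r (x \<otimes>\<^bsub>Z2_power (Suc n)\<^esub> y) = r x \<otimes>\<^bsub>Z2_power n\<^esub> r y" for x y
    by (auto simp: r_def mult_Z2_power)
  then have h_mult: "h (r (x \<otimes>\<^bsub>Z2_power (Suc n)\<^esub> y)) = h (r x) \<otimes> h (r y)"
    if "x \<in> carrier (Z2_power (Suc n))" "y \<in> carrier (Z2_power (Suc n))" for x y
    using hom_mult[OF h(1) r r] that by simp
  have d_mult: "d (x \<otimes>\<^bsub>Z2_power (Suc n)\<^esub> y) = d x \<otimes> d y"
    if "x \<in> carrier (Z2_power (Suc n))" "y \<in> carrier (Z2_power (Suc n))" for x y
    using last[OF that(1)] last[OF that(2)] g sq by (auto simp: d_def mult_Z2_power)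
  define h' where "h' x = h (r x) \<otimes> d x" for x
  have "h' \<in> hom (Z2_power (Suc n)) G"
    using hr d by (intro homI) (auto simp: h'_def h_mult d_mult m_ac)
  moreover have "inj_on h' (carrier (Z2_power (Suc n)))"
  proof (rule inj_onI)
    fix x y
    assume x: "x \<in> carrier (Z2_power (Suc n))" and y: "y \<in> carrier (Z2_power (Suc n))"
      and eq: "h' x = h' y"
    \<comment> \<open>Otherwise multiplication by the involution \<open>h (r y)\<close> or identity
      would put \<open>g\<close> into the image of \<open>h\<close>.\<close>
    have no: "h (r x) \<noteq> h (r y) \<otimes> g"
      if x: "x \<in> carrier (Z2_power (Suc n))" and y: "y \<in> carrier (Z2_power (Suc n))" for x y
    proof
      assume "h (r x) = h (r y) \<otimes> g"
      then have "h (r y) \<otimes> h (r x) = (h (r y) \<otimes> h (r y)) \<otimes> g"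
        using hr[OF y] g by (simp add: m_assoc)
      then have "g = h (r y \<otimes>\<^bsub>Z2_power n\<^esub> r x)"
        using hr[OF y] g sq hom_mult[OF h(1) r[OF y] r[OF x]] by simp
      then show False
        using g(2) r[OF x] r[OF y] group.is_monoid[OF group_Z2_power]
        by (metis imageI monoid.m_closed)
    qed
    have "x n = y n"
      using eq last[OF x] last[OF y] no[OF x y] no[OF y x] hr[OF x] hr[OF y]
      by (auto simp: h'_def d_def)
    then have "h (r x) = h (r y)"
      using eq hr[OF x] hr[OF y] d by (simp add: h'_def d_def split: if_splits)
    then have "r x = r y"
      using h(2) r[OF x] r[OF y] by (simp add: inj_on_def)
    then have "x k = y k" if "k < n" for k
      using that by (metis r_def restrict_apply' lessThan_iff)
    with \<open>x n = y n\<close> show "x = y"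
      using x y unfolding carrier_Z2_power by (intro PiE_ext) (auto simp: less_Suc_eq)
  qed
  ultimately show ?case
    by blast
qed

lemma (in comm_group) elementary_abelian_iso:
  assumes sq: "\<And>x. x \<in> carrier G \<Longrightarrow> x \<otimes> x = \<one>"
    and "order G = 2 ^ n"
  shows "G \<cong> Z2_power n"
proof -
  have fin: "finite (carrier G)"
    using assms(2) by (intro card_ge_0_finite) (simp add: order_def)
  then obtain h where h: "h \<in> hom (Z2_power n) G" "inj_on h (carrier (Z2_power n))"
    using elementary_abelian_embedding[OF sq] assms(2) by auto
  have "h ` carrier (Z2_power n) = carrier G"
    using h assms(2) fin
    by (intro card_subset_eq) (auto simp: hom_def card_image card_carrier_Z2_power order_def)
  then have "h \<in> iso (Z2_power n) G"
    using h by (simp add: iso_def bij_betw_def)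
  then show ?thesis
    using group.iso_sym[OF group_Z2_power] by (auto simp: is_iso_def)
qed

section \<open>Fields of order \<open>2\<^sup>q\<close>\<close>

text \<open>The order of the additive group annihilates the unit, so
  \<open>\<one> \<oplus> \<one>\<close> has a vanishing \<open>q\<close>-th power and is itself
  zero.\<close>

lemma (in field) char_2_if_order_power_2:
  assumes "order R = 2 ^ q" and "q > 0" and x: "x \<in> carrier R"
  shows "x \<oplus> x = \<zero>"
proof -
  have pow: "[(2 ^ k :: nat)] \<cdot> \<one> = (\<one> \<oplus> \<one>) [^] k" for k
  proof (induction k)
    case (Suc k)
    have "[(2 ^ Suc k :: nat)] \<cdot> \<one> = [(2 ^ k + 2 ^ k :: nat)] \<cdot> \<one>"
      by (simp add: mult_2)
    also have "\<dots> = [(2 ^ k :: nat)] \<cdot> \<one> \<oplus> [(2 ^ k :: nat)] \<cdot> \<one>"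
      by (simp add: add.nat_pow_mult)
    also have "\<dots> = (\<one> \<oplus> \<one>) [^] Suc k"
      by (simp add: Suc r_distr)
    finally show ?case .
  qed simp
  have "[order R] \<cdot> \<one> = \<zero>"
    using add.pow_order_eq_1[of \<one>] by (simp add: order_def)
  then have "(\<one> \<oplus> \<one>) [^] q = \<zero>"
    by (simp add: assms(1) pow)
  then have "\<one> \<oplus> \<one> = \<zero>"
    using monoid.nat_pow_closed[OF group.is_monoid[OF field_mult_group], of "\<one> \<oplus> \<one>" q]
    by (auto simp: nat_pow_mult_of)
  then have "(\<one> \<oplus> \<one>) \<otimes> x = \<zero>"
    using x by simp
  then show ?thesis
    using x by (simp add: l_distr)
qed

lemma (in cring) frobenius_char_2:
  assumes char: "\<And>x. x \<in> carrier R \<Longrightarrow> x \<oplus> x = \<zero>"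
    and x: "x \<in> carrier R" and y: "y \<in> carrier R"
  shows "(x \<oplus> y) [^] (2 ^ k :: nat) = x [^] (2 ^ k :: nat) \<oplus> y [^] (2 ^ k :: nat)"
proof (induction k)
  case 0
  show ?case using x y by simp
next
  case (Suc k)
  let ?x = "x [^] (2 ^ k :: nat)" and ?y = "y [^] (2 ^ k :: nat)"
  have xy: "?x \<in> carrier R" "?y \<in> carrier R"
    using x y by simp_all
  have double: "z [^] (2 ^ Suc k :: nat) = z [^] (2 ^ k :: nat) \<otimes> z [^] (2 ^ k :: nat)"
    if "z \<in> carrier R" for z
    using that by (simp add: nat_pow_mult mult_2)
  have "(x \<oplus> y) [^] (2 ^ Suc k :: nat) = (?x \<oplus> ?y) \<otimes> (?x \<oplus> ?y)"
    using x y by (simp only: double Suc add.m_closed)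
  also have "\<dots> = ?x \<otimes> ?x \<oplus> (?x \<otimes> ?y \<oplus> ?x \<otimes> ?y) \<oplus> ?y \<otimes> ?y"
    using xy by (simp add: l_distr r_distr m_comm a_ac)
  also have "\<dots> = ?x \<otimes> ?x \<oplus> ?y \<otimes> ?y"
    using xy by (simp add: char)
  finally show ?case
    using x y by (simp only: double)
qed

text \<open>Assumption \<open>exp\<close> is the field form of the divisibility by \<open>p\<close>.
  With it, \<open>eq\<close> says that \<open>a\<close> squared plus \<open>a\<close> plus 1, times
  \<open>c\<close>, is \<open>a\<close> squared; multiplying by
  \<open>b \<otimes> b \<otimes> d\<close> gives
  \<open>d = \<one> \<oplus> b \<oplus> b \<otimes> b\<close>.\<close>

lemma (in field) shifted_inverse_relation:
  fixes a :: 'a and i j :: nat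
  assumes char: "\<And>x. x \<in> carrier R \<Longrightarrow> x \<oplus> x = \<zero>"
    and a: "a \<in> carrier R" "a \<noteq> \<zero>"
    and eq: "a [^] (2 * i) \<oplus> a [^] (2::nat) \<oplus> a \<oplus> \<one> = \<zero>"
    and exp: "a [^] (2 * i + 2 ^ Suc j) = a [^] (2::nat)"
  shows "(\<one> \<oplus> inv a) [^] (2 ^ Suc j :: nat) = inv a \<otimes> (\<one> \<oplus> inv a)"
proof -
  define b where "b = inv a"
  have b: "b \<in> carrier R" "a \<otimes> b = \<one>"
    using a by (simp_all add: b_def field_Units)
  define c where "c = a [^] (2 ^ Suc j :: nat)"
  define d where "d = b [^] (2 ^ Suc j :: nat)"
  have cd: "c \<in> carrier R" "d \<in> carrier R"
    using a b by (simp_all add: c_def d_def)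
  have "c \<otimes> d = (a \<otimes> b) [^] (2 ^ Suc j :: nat)"
    unfolding c_def d_def using a b(1) by (simp only: nat_pow_distrib)
  then have cd1: "c \<otimes> d = \<one>"
    using b by simp
  have "a [^] (2 * i) = a \<otimes> a \<oplus> a \<oplus> \<one>"
  proof -
    have sq: "a [^] (2::nat) = a \<otimes> a"
      using a by (simp add: numeral_2_eq_2)
    let ?s = "a \<otimes> a \<oplus> a \<oplus> \<one>"
    have "a [^] (2 * i) \<oplus> ?s = \<zero>"
      using eq a by (simp add: sq a_assoc)
    moreover have "?s \<oplus> ?s = \<zero>"
      using a by (intro char) simp
    ultimately show ?thesis
      using a by (metis add.m_closed add.right_cancel m_closed nat_pow_closed one_closed)
  qed
  moreover have "a [^] (2 * i) \<otimes> c = a \<otimes> a"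
    using exp a by (simp add: c_def nat_pow_mult numeral_2_eq_2)
  ultimately have "b \<otimes> b \<otimes> ((a \<otimes> a \<oplus> a \<oplus> \<one>) \<otimes> c \<otimes> d) = b \<otimes> b \<otimes> (a \<otimes> a \<otimes> d)"
    by simp
  moreover have "b \<otimes> b \<otimes> (a \<otimes> a \<otimes> d) = (a \<otimes> b) \<otimes> (a \<otimes> b) \<otimes> d"
    using a b(1) cd by (simp add: m_ac)
  moreover have "b \<otimes> b \<otimes> ((a \<otimes> a \<oplus> a \<oplus> \<one>) \<otimes> c \<otimes> d) =
      ((a \<otimes> b) \<otimes> (a \<otimes> b) \<oplus> (a \<otimes> b) \<otimes> b \<oplus> b \<otimes> b) \<otimes> (c \<otimes> d)"
    using a b(1) cd by (simp add: l_distr r_distr m_ac)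
  ultimately have d: "d = \<one> \<oplus> b \<oplus> b \<otimes> b"
    using b cd cd1 by simp
  have "(\<one> \<oplus> b) [^] (2 ^ Suc j :: nat) = \<one> \<oplus> d"
    unfolding d_def using frobenius_char_2[OF char one_closed b(1), of "Suc j"] by simp
  also have "\<dots> = (\<one> \<oplus> \<one>) \<oplus> (b \<oplus> b \<otimes> b)"
    using b unfolding d by (simp add: a_assoc)
  also have "\<dots> = b \<otimes> (\<one> \<oplus> b)"
    using b by (simp add: char r_distr)
  finally show ?thesis
    by (simp add: b_def)
qed

section \<open>From the field to the exponent form\<close>

theorem theorem4:
  fixes F :: "('a, 'm) ring_scheme" and a :: 'a and p q i j :: nat
  assumes "q \<ge> 3"
    and "p = 2 ^ q - 1"
    and "Factorial_Ring.prime p"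
    and "field F"
    and "order F = 2 ^ q"
    and "primitive_element F a"
    and "i > 0"
    and "a [^]\<^bsub>F\<^esub> (2 * i) \<oplus>\<^bsub>F\<^esub> a [^]\<^bsub>F\<^esub> (2::nat) \<oplus>\<^bsub>F\<^esub> a \<oplus>\<^bsub>F\<^esub> \<one>\<^bsub>F\<^esub> = \<zero>\<^bsub>F\<^esub>"
    and "j > 0"
    and "p dvd 2 ^ j + i - 1"
  shows "\<exists>T. minimal_latin_trade (Z2_power q) T \<and> homogeneous q T \<and> card T = p * q"
proof -
  interpret field F by fact
  interpret M: group "mult_of F"
    by (rule field_mult_group)
  have P: "int p = 2 ^ q - 1"
    using assms(2) by (simp add: of_nat_diff)
  have "finite (carrier F)"
    using assms(5) by (intro card_ge_0_finite) (simp add: order_def)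
  then have order_M: "order (mult_of F) = p"
    using assms(2,5) by (simp add: order_mult_of)
  have char: "x \<oplus>\<^bsub>F\<^esub> x = \<zero>\<^bsub>F\<^esub>" if "x \<in> carrier F" for x
    using char_2_if_order_power_2[OF assms(5) _ that] assms(1) by simp

  have a: "a \<in> carrier F" "a \<noteq> \<zero>\<^bsub>F\<^esub>" "a \<in> carrier (mult_of F)"
    using assms(6) by (auto simp: primitive_element_def)
  have "a \<noteq> \<one>\<^bsub>F\<^esub>"
  proof
    assume "a = \<one>\<^bsub>F\<^esub>"
    then have "M.ord a = 1"
      using M.ord_id by simp
    moreover have "M.ord a = p"
      using M.generate_pow_card[OF a(3)] assms(6) order_M
      by (simp add: primitive_element_def order_def)
    ultimately show False
      using assms(3) by simp
  qed
  have "a [^]\<^bsub>F\<^esub> p = \<one>\<^bsub>F\<^esub>"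
    using M.pow_order_eq_1[OF a(3)] by (simp add: order_M nat_pow_mult_of)
  moreover obtain m where "2 ^ j + i - 1 = p * m"
    using assms(10) by blast
  \<comment> \<open>Twice the divisibility assumption; the subtraction is genuine because
    \<open>2 ^ j\<close> is at least 1.\<close>
  then have "2 * i + 2 ^ Suc j = p * (2 * m) + 2"
    using one_le_power[of "2 :: nat" j] mult.left_commute[of p 2 m] power_Suc[of "2 :: nat" j]
    by linarith
  ultimately have exp: "a [^]\<^bsub>F\<^esub> (2 * i + 2 ^ Suc j) = a [^]\<^bsub>F\<^esub> (2::nat)"
    using a(1) by (simp add: numeral_2_eq_2 flip: nat_pow_mult nat_pow_pow)

  define b where "b = inv\<^bsub>F\<^esub> a"
  define u where "u = \<one>\<^bsub>F\<^esub> \<oplus>\<^bsub>F\<^esub> b"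
  have "a \<in> Units F"
    using a by (simp add: field_Units)
  then have "b \<in> carrier F" "a \<otimes>\<^bsub>F\<^esub> b = \<one>\<^bsub>F\<^esub>"
    by (simp_all add: b_def)
  then have b: "b \<in> carrier F" "b \<noteq> \<zero>\<^bsub>F\<^esub>" "b \<noteq> \<one>\<^bsub>F\<^esub>"
    using a \<open>a \<noteq> \<one>\<^bsub>F\<^esub>\<close> by auto
  then have u: "u \<in> carrier F" "u \<noteq> \<zero>\<^bsub>F\<^esub>" "u \<noteq> \<one>\<^bsub>F\<^esub>"
    using char[OF one_closed] add.right_cancel[of "\<one>\<^bsub>F\<^esub>" b "\<one>\<^bsub>F\<^esub>"]
      add.right_cancel[of "\<one>\<^bsub>F\<^esub>" b "\<zero>\<^bsub>F\<^esub>"]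
    by (auto simp: u_def a_comm)
  have uM: "u \<in> carrier (mult_of F)"
    using u by simp
  have rel: "u [^]\<^bsub>F\<^esub> (2 ^ Suc j :: nat) = b \<otimes>\<^bsub>F\<^esub> u"
    unfolding u_def b_def using char a(1,2) assms(8) exp by (rule shifted_inverse_relation)
  have b_pow: "b = u [^]\<^bsub>F\<^esub> (2 ^ Suc j - 1 :: nat)"
  proof -
    have "u [^]\<^bsub>F\<^esub> (2 ^ Suc j :: nat) = u [^]\<^bsub>F\<^esub> (2 ^ Suc j - 1 :: nat) \<otimes>\<^bsub>F\<^esub> u"
      by (metis Suc_pred' nat_pow_Suc zero_less_numeral zero_less_power)
    with rel have "b \<otimes>\<^bsub>F\<^esub> u = u [^]\<^bsub>F\<^esub> (2 ^ Suc j - 1 :: nat) \<otimes>\<^bsub>F\<^esub> u"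
      by (simp only:)
    then show ?thesis
      using m_rcancel[OF u(2,1) b(1) nat_pow_closed[OF u(1)]] by blast
  qed
  have N_int: "int (2 ^ Suc j - 1) = 2 * 2 ^ j - 1"
    by (simp add: of_nat_diff)
  have b_int_pow: "b = u [^]\<^bsub>mult_of F\<^esub> (2 * 2 ^ j - 1 :: int)"
    unfolding N_int[symmetric] int_pow_int nat_pow_mult_of by (rule b_pow)
  \<comment> \<open>The order divides the prime \<open>p\<close> and is not 1, so \<open>u\<close>
    is a generator.\<close>
  have ord_u: "M.ord u = p"
    using M.ord_dvd_group_order[OF uM] M.ord_eq_1[OF uM] u(3) assms(3) order_M
    by (auto simp: prime_nat_iff)

  obtain \<phi> where \<phi>: "\<phi> \<in> iso (add_monoid F) (Z2_power q)"
    using comm_group.elementary_abelian_iso[OF a_comm_group, of q] char assms(5)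
    by (auto simp: is_iso_def order_def)
  define E where "E z = \<phi> (u [^]\<^bsub>mult_of F\<^esub> z)" for z :: int
  have upow: "u [^]\<^bsub>mult_of F\<^esub> z \<in> carrier F" for z :: int
    using M.int_pow_closed[OF uM, of z] by simp
  have E_eq: "E z = E w \<longleftrightarrow> [z = w] (mod (2 ^ q - 1))" for z w
  proof -
    have "E z = E w \<longleftrightarrow> u [^]\<^bsub>mult_of F\<^esub> z = u [^]\<^bsub>mult_of F\<^esub> w"
      using \<phi> upow by (auto simp: E_def iso_def bij_betw_def inj_on_def)
    then show ?thesis
      by (simp add: M.int_pow_eq[OF uM] ord_u P cong_iff_dvd_diff dvd_diff_commute)
  qed
  have E_mult: "E z \<otimes>\<^bsub>Z2_power q\<^esub> E (z + (2 * 2 ^ j - 1) * 2 ^ k) = E (z + 2 ^ k)" for z k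
  proof -
    let ?x = "u [^]\<^bsub>mult_of F\<^esub> z"
    have k_int: "(2 ^ k :: int) = int (2 ^ k)"
      by simp
    have bk: "u [^]\<^bsub>mult_of F\<^esub> ((2 * 2 ^ j - 1) * 2 ^ k :: int) = b [^]\<^bsub>F\<^esub> (2 ^ k :: nat)"
      unfolding b_int_pow M.int_pow_pow[OF uM, symmetric] k_int int_pow_int nat_pow_mult_of ..
    have uk: "u [^]\<^bsub>mult_of F\<^esub> (2 ^ k :: int) = \<one>\<^bsub>F\<^esub> \<oplus>\<^bsub>F\<^esub> b [^]\<^bsub>F\<^esub> (2 ^ k :: nat)"
      unfolding k_int int_pow_int nat_pow_mult_of
      using frobenius_char_2[OF char one_closed b(1), of k] by (simp add: u_def)
    \<comment> \<open>Factoring out \<open>?x\<close> leaves \<open>\<one>\<close> plus a Frobenius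
      power of \<open>b\<close>, which is the same power of \<open>u\<close>.\<close>
    have "?x \<oplus>\<^bsub>F\<^esub> u [^]\<^bsub>mult_of F\<^esub> (z + (2 * 2 ^ j - 1) * 2 ^ k) =
        ?x \<oplus>\<^bsub>F\<^esub> ?x \<otimes>\<^bsub>F\<^esub> b [^]\<^bsub>F\<^esub> (2 ^ k :: nat)"
      by (simp add: M.int_pow_mult[OF uM] bk)
    also have "\<dots> = ?x \<otimes>\<^bsub>F\<^esub> u [^]\<^bsub>mult_of F\<^esub> (2 ^ k :: int)"
      using upow[of z] b(1) by (simp add: uk r_distr)
    also have "\<dots> = u [^]\<^bsub>mult_of F\<^esub> (z + 2 ^ k)"
      by (simp add: M.int_pow_mult[OF uM])
    finally have "E (z + 2 ^ k) = \<phi> (?x \<oplus>\<^bsub>F\<^esub> u [^]\<^bsub>mult_of F\<^esub> (z + (2 * 2 ^ j - 1) * 2 ^ k))"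
      by (simp add: E_def)
    also have "\<dots> = E z \<otimes>\<^bsub>Z2_power q\<^esub> E (z + (2 * 2 ^ j - 1) * 2 ^ k)"
      using \<phi> upow by (simp add: E_def iso_def hom_def)
    finally show ?thesis ..
  qed
  have "b \<noteq> u"
    using b(1) add.right_cancel[of b "\<zero>\<^bsub>F\<^esub>" "\<one>\<^bsub>F\<^esub>"] by (auto simp: u_def)
  \<comment> \<open>If \<open>N\<close> were 1 modulo \<open>p\<close>, the exponent
    \<open>2 * N - 1\<close> would be 1 and \<open>b\<close> would equal \<open>u\<close>.\<close>
  have N1: "\<not> [2 ^ j = 1] (mod (2 ^ q - 1 :: int))"
  proof
    assume "[2 ^ j = 1] (mod (2 ^ q - 1 :: int))"
    then have "(2 ^ q - 1 :: int) dvd 2 * (2 ^ j - 1)"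
      unfolding cong_iff_dvd_diff by (rule dvd_mult)
    then have "int (M.ord u) dvd (2 * 2 ^ j - 1) - 1"
      by (simp add: ord_u P algebra_simps)
    then have "u [^]\<^bsub>mult_of F\<^esub> (1 :: int) = b"
      by (simp only: b_int_pow M.int_pow_eq[OF uM])
    then show False
      using \<open>b \<noteq> u\<close> uM by (simp add: M.int_pow_1)
  qed
  have N2: "\<not> [2 * 2 ^ j = 1] (mod (2 ^ q - 1 :: int))"
  proof
    assume "[2 * 2 ^ j = 1] (mod (2 ^ q - 1 :: int))"
    then have "b = \<one>\<^bsub>mult_of F\<^esub>"
      unfolding b_int_pow M.int_pow_eq_id[OF uM] by (simp add: ord_u P cong_iff_dvd_diff)
    then show False
      using b(3) by simp
  qed
  interpret trade: mersenne_trade "Z2_power q" E q j "2 ^ q - 1" "2 ^ j"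
  proof (rule mersenne_trade.intro)
    show "E z \<in> carrier (Z2_power q)" for z
      using \<phi> upow by (auto simp: E_def iso_def hom_def)
  qed (use assms(2,3) group_Z2_power E_eq E_mult N1 N2 in auto)
  have "nat (2 ^ q - 1) = p"
    using P by simp
  then show ?thesis
    using trade.minimal_latin_trade_T trade.homogeneous_T trade.card_T by metis
qed

end
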